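(* Let $\Phi$, $j$, $\nu$, $\mathcal J$, $\varphi$, $V$ be as in the standing assumption (see context), and suppose $\varphi\in\mathcal Z_C(\mathbb R^d)$ for some constant $C\in(0,1)$, with associated $M_\varphi$, $L_\varphi$. Then $$|V(x)|\le\frac12\,\frac{L_\varphi(x)}{\varphi(x)}\,\mathcal J(C|x|)+2\|\varphi\|_\infty\,\frac{\nu(B^c_{C|x|}(0))}{\varphi(x)},\qquad x\in B^c_{M_\varphi}(0).$$ In particular, if $$\lim_{|x|\to\infty}\frac{L_\varphi(x)\mathcal J(C|x|)}{\varphi(x)}=0\quad\text{and}\quad\lim_{|x|\to\infty}\frac{\nu(B^c_{C|x|}(0))}{\varphi(x)}=0,$$ then $\lim_{|x|\to\infty}V(x)=0$.
   Context: Notation: $B_r(a)$ is the open ball in $\mathbb R^d$, $B_r^c(a)$ its complement; $D_hf(x)=f(x+h)-2f(x)+f(x-h)$. $\Phi$ is a complete Bernstein function with Lévy pair $(0,\mu)$: $\Phi(u)=\int_0^\infty(1-e^{-ut})\mu(t)\,dt$ with $\mu:(0,\infty)\to[0,\infty)$ completely monotone and $\int_0^\infty\min(1,t)\mu(t)\,dt<\infty$. The jump kernel is $j(r)=(4\pi)^{-d/2}\int_0^\infty t^{-d/2}e^{-r^2/(4t)}\mu(t)\,dt$, $r>0$; $\nu(dx)=j(|x|)\,dx$ on $\mathbb R^d\setminus\{0\}$, and $\mathcal J(R)=\int_{B_R(0)}|h|^2j(|h|)\,dh$. $\Phi(-\Delta)$ is the operator on $L^2(\mathbb R^d)$ with Fourier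 multiplier $\Phi(|y|^2)$. Standing assumption: $V:\mathbb R^d\to\mathbb R$ is a potential, $H=\Phi(-\Delta)+V$, and $\varphi\in L^2(\mathbb R^d)\cap L^\infty(\mathbb R^d)$, $\varphi>0$, satisfies $H\varphi=0$. The potential is understood through the pointwise expression $V(x)=-\frac{1}{\varphi(x)}\Phi(-\Delta)\varphi(x)=\frac{1}{2\varphi(x)}\int_{\mathbb R^d}D_h\varphi(x)\,j(|h|)\,dh$. Space: for $C\in(0,1)$, $\mathcal Z_C(\mathbb R^d)$ is the set of $f\in L^\infty(\mathbb R^d)$ for which there exist $M_f>0$ and $L_f\in L^\infty(B^c_{M_f}(0))$ such that $|D_hf(x)|\le L_f(x)|h|^2$ for all $x\in B^c_{M_f}(0)$ and $h\in B_{C|x|}(0)$. *)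

theory Defs
  imports "HOL-Analysis.Analysis" "HOL-Probability.Essential_Supremum"
begin

section \<open>Complete Bernstein functions and the jump kernel\<close>

definition completely_monotone :: "(real \<Rightarrow> real) \<Rightarrow> bool" where
  "completely_monotone \<mu> \<longleftrightarrow>
     (\<forall>n. \<forall>t>0. (deriv ^^ n) \<mu> differentiable (at t) \<and> (-1) ^ n * (deriv ^^ n) \<mu> t \<ge> 0)"

definition complete_Bernstein_with_density :: "(real \<Rightarrow> real) \<Rightarrow> (real \<Rightarrow> real) \<Rightarrow> bool" where
  "complete_Bernstein_with_density \<Phi> \<mu> \<longleftrightarrow>
     completely_monotone \<mu> \<and>
     set_integrable lebesgue {0<..} (\<lambda>t. min 1 t * \<mu> t) \<and>
     (\<forall>u>0. \<Phi> u = (LINT t:{0<..}|lebesgue. (1 - exp (- u * t)) * \<mu> t))"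

definition jump_kernel :: "nat \<Rightarrow> (real \<Rightarrow> real) \<Rightarrow> real \<Rightarrow> real" where
  "jump_kernel d \<mu> r = (4 * pi) powr (- real d / 2) *
     (LINT t:{0<..}|lebesgue. t powr (- real d / 2) * exp (- r\<^sup>2 / (4 * t)) * \<mu> t)"

definition jump_measure :: "(real \<Rightarrow> real) \<Rightarrow> (real ^ 'd::finite) measure" where
  "jump_measure \<mu> =
     density (lebesgue_on (- {0})) (\<lambda>h. ennreal (jump_kernel CARD('d) \<mu> (norm h)))"

text \<open>The dimension of the domain of integration cannot be read off the arguments and the
  result type, so it is passed as \<open>TYPE('d)\<close>.\<close>

definition jump_second_moment :: "'d::finite itself \<Rightarrow> (real \<Rightarrow> real) \<Rightarrow> real \<Rightarrow> real" where
  "jump_second_moment _ \<mu> R =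
     (LINT h:ball (0 :: real ^ 'd) R|lebesgue. (norm h)\<^sup>2 * jump_kernel CARD('d) \<mu> (norm h))"

section \<open>Function spaces\<close>

text \<open>Members of the two spaces below are functions, not almost-everywhere classes.\<close>

definition L2_space :: "((real ^ 'd::finite) \<Rightarrow> 'b::{real_normed_vector, second_countable_topology}) set"
  where "L2_space =
    {f. f \<in> borel_measurable lebesgue \<and> integrable lebesgue (\<lambda>x. (norm (f x))\<^sup>2)}"

definition Linf_space :: "'a measure \<Rightarrow> ('a \<Rightarrow> real) set" where
  "Linf_space M = {f. f \<in> borel_measurable M \<and> esssup M (\<lambda>x. ereal \<bar>f x\<bar>) < \<infinity>}"

definition Linf_norm :: "'a measure \<Rightarrow> ('a \<Rightarrow> real) \<Rightarrow> real" where
  "Linf_norm M f = real_of_ereal (esssup M (\<lambda>x. ereal \<bar>f x\<bar>))"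

definition second_diff :: "'a::real_vector \<Rightarrow> ('a \<Rightarrow> real) \<Rightarrow> 'a \<Rightarrow> real" where
  "second_diff h f x = f (x + h) - 2 * f x + f (x - h)"

definition Z_bound :: "real \<Rightarrow> (real ^ 'd::finite \<Rightarrow> real) \<Rightarrow> real \<Rightarrow> (real ^ 'd \<Rightarrow> real) \<Rightarrow> bool" where
  "Z_bound C f M L \<longleftrightarrow>
     M > 0 \<and> L \<in> Linf_space (lebesgue_on (- ball 0 M)) \<and>
     (\<forall>x \<in> - ball 0 M. \<forall>h \<in> ball 0 (C * norm x). \<bar>second_diff h f x\<bar> \<le> L x * (norm h)\<^sup>2)"

definition Z_space :: "real \<Rightarrow> (real ^ 'd::finite \<Rightarrow> real) set" where
  "Z_space C = {f \<in> Linf_space lebesgue. \<exists>M L. Z_bound C f M L}"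

section \<open>The operators\<close>

definition fourier_integral :: "(real ^ 'd::finite \<Rightarrow> complex) \<Rightarrow> real ^ 'd \<Rightarrow> complex" where
  "fourier_integral f y =
     complex_of_real ((2 * pi) powr (- real CARD('d) / 2)) *
       (LINT x|lebesgue. cis (- (y \<bullet> x)) * f x)"

text \<open>\<open>F\<close> is the Fourier--Plancherel transform of \<open>f\<close>: the \<open>L\<^sup>2\<close> limit of the transforms of the
  truncations of \<open>f\<close> to balls, which are integrable.\<close>

definition is_L2_fourier :: "(real ^ 'd::finite \<Rightarrow> complex) \<Rightarrow> (real ^ 'd \<Rightarrow> complex) \<Rightarrow> bool" where
  "is_L2_fourier f F \<longleftrightarrow> f \<in> L2_space \<and> F \<in> L2_space \<and>
     ((\<lambda>R::real. \<integral>\<^sup>+ y. ennreal ((norm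
         (F y - fourier_integral (\<lambda>x. if x \<in> ball 0 R then f x else 0) y))\<^sup>2) \<partial>lebesgue)
       \<longlongrightarrow> 0) at_top"

text \<open>Graphs of the unbounded operators \<open>\<Phi>(-\<Delta>)\<close> and \<open>H = \<Phi>(-\<Delta>) + V\<close>: the relation holds iff \<open>f\<close>
  is in the \<open>L\<^sup>2\<close> domain and the operator maps it to \<open>g\<close> (almost everywhere).\<close>

definition Phi_Laplacian_graph ::
  "(real \<Rightarrow> real) \<Rightarrow> (real ^ 'd::finite \<Rightarrow> complex) \<Rightarrow> (real ^ 'd \<Rightarrow> complex) \<Rightarrow> bool" where
  "Phi_Laplacian_graph \<Phi> f g \<longleftrightarrow>
     (\<exists>F G. is_L2_fourier f F \<and> is_L2_fourier g G \<and>
        (AE y in lebesgue. G y = complex_of_real (\<Phi> ((norm y)\<^sup>2)) * F y))"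

definition Schroedinger_graph ::
  "(real \<Rightarrow> real) \<Rightarrow> (real ^ 'd::finite \<Rightarrow> real) \<Rightarrow>
   (real ^ 'd \<Rightarrow> complex) \<Rightarrow> (real ^ 'd \<Rightarrow> complex) \<Rightarrow> bool" where
  "Schroedinger_graph \<Phi> V f g \<longleftrightarrow>
     (\<lambda>x. complex_of_real (V x) * f x) \<in> L2_space \<and>
     (\<exists>\<psi>. Phi_Laplacian_graph \<Phi> f \<psi> \<and>
        (AE x in lebesgue. g x = \<psi> x + complex_of_real (V x) * f x))"

text \<open>The equation \<open>H\<phi> = 0\<close> determines \<open>V\<close> only almost everywhere; the pointwise formula fixes its
  values wherever its integral converges absolutely. For \<open>\<phi>\<close> in \<open>Z_space C\<close> with bound \<open>(M, L)\<close> that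
  is the case at every point with \<open>norm x \<ge> M\<close>; the proviso avoids attributing to \<open>V\<close> the
  library's default value \<open>0\<close> of a non-convergent integral elsewhere.\<close>

definition pointwise_potential ::
  "(real \<Rightarrow> real) \<Rightarrow> (real ^ 'd::finite \<Rightarrow> real) \<Rightarrow> (real ^ 'd \<Rightarrow> real) \<Rightarrow> bool" where
  "pointwise_potential \<mu> \<phi> V \<longleftrightarrow>
     (\<forall>x. integrable lebesgue (\<lambda>h. second_diff h \<phi> x * jump_kernel CARD('d) \<mu> (norm h)) \<longrightarrow>
        V x = 1 / (2 * \<phi> x) *
          (LINT h|lebesgue. second_diff h \<phi> x * jump_kernel CARD('d) \<mu> (norm h)))"

definition zero_energy_setting ::
  "(real \<Rightarrow> real) \<Rightarrow> (real \<Rightarrow> real) \<Rightarrow> (real ^ 'd::finite \<Rightarrow> real) \<Rightarrow> (real ^ 'd \<Rightarrow> real) \<Rightarrow> bool" where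
  "zero_energy_setting \<Phi> \<mu> V \<phi> \<longleftrightarrow>
     complete_Bernstein_with_density \<Phi> \<mu> \<and>
     \<phi> \<in> L2_space \<and> \<phi> \<in> Linf_space lebesgue \<and> (\<forall>x. \<phi> x > 0) \<and>
     Schroedinger_graph \<Phi> V (\<lambda>x. complex_of_real (\<phi> x)) (\<lambda>x. 0) \<and>
     pointwise_potential \<mu> \<phi> V"

end

theory Submission
  imports Defs "HOL-Probability.Distributions"
begin

text \<open>
  The bound comes from splitting \<open>2 \<phi>(x) V(x) = \<integral> D\<^sub>h\<phi>(x) j(|h|) dh\<close> at \<open>|h| = C|x|\<close>. Inside the ball the
  second difference is at most \<open>L(x) |h|\<^sup>2\<close>, which integrates to \<open>L(x) \<J>(C|x|)\<close>; outside, it is bounded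
  by a multiple of \<open>\<parallel>\<phi>\<parallel>\<^sub>\<infinity>\<close>, which integrates to that multiple of \<open>\<nu>(B\<^sup>c)\<close>. The limit at
  infinity follows by comparison. Two points of this argument need work.

  First, the integral has to converge absolutely, since only then does the formula determine \<open>V(x)\<close>.
  This is the Levy property \<open>\<integral> min(1, |h|\<^sup>2) j(|h|) dh < \<infinity>\<close>, proved in
  \<open>jump_kernel_Levy_integrable\<close>: \<open>j\<close> is a mixture of heat kernels with weight \<open>\<mu>(t) dt\<close>, the
  integral of \<open>min(1, |h|\<^sup>2)\<close> against the heat kernel at time \<open>t\<close> is at most a constant
  times \<open>min(1, t)\<close> (\<open>heat_kernel_truncated_moment\<close>), and \<open>min(1, t) \<mu>(t)\<close> is integrable. Tonelli's theorem
  joins the two.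

  Secondly, \<open>\<parallel>\<phi>\<parallel>\<^sub>\<infinity>\<close> is an essential supremum and controls \<open>\<phi>(x \<plusminus> h)\<close> for almost every \<open>h\<close>, but says
  nothing about the value \<open>\<phi>(x)\<close> at the single point \<open>x\<close>, which also occurs in \<open>D\<^sub>h\<phi>(x)\<close>. Here the
  local bound helps again: \<open>D\<^sub>h\<phi>(x) \<rightarrow> 0\<close> as \<open>h \<rightarrow> 0\<close> makes \<open>\<phi>(x)\<close> a limit of averages of
  values that are at most \<open>\<parallel>\<phi>\<parallel>\<^sub>\<infinity>\<close>, so \<open>\<phi>(x) \<le> \<parallel>\<phi>\<parallel>\<^sub>\<infinity>\<close> (\<open>second_diff_AE_bound\<close>).
\<close>

section \<open>Gaussian integrals and truncated moments of the heat kernel\<close>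

lemma nn_integral_gaussian_real:
  fixes s :: real
  assumes "0 < s"
  shows "(\<integral>\<^sup>+ x. ennreal (exp (- x\<^sup>2 / s)) \<partial>lborel) = ennreal (sqrt (pi * s))"
proof -
  have "exp (- x\<^sup>2 / s) = sqrt (pi * s) * normal_density 0 (sqrt (s / 2)) x" for x
    using assms by (simp add: normal_density_def real_sqrt_mult)
  then have "(\<integral>\<^sup>+ x. ennreal (exp (- x\<^sup>2 / s)) \<partial>lborel)
      = ennreal (sqrt (pi * s)) * (\<integral>\<^sup>+ x. ennreal (normal_density 0 (sqrt (s / 2)) x) \<partial>lborel)"
    using assms by (simp add: ennreal_mult' nn_integral_cmult)
  also have "(\<integral>\<^sup>+ x. ennreal (normal_density 0 (sqrt (s / 2)) x) \<partial>lborel) = 1"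
    using assms by (subst nn_integral_eq_integral) auto
  finally show ?thesis by simp
qed

text \<open>The Gaussian factorises over the coordinates, so the integral is a power of the one on the line.\<close>

lemma nn_integral_gaussian:
  fixes s :: real
  assumes "0 < s"
  shows "(\<integral>\<^sup>+ h. ennreal (exp (- (norm (h :: 'a::euclidean_space))\<^sup>2 / s)) \<partial>lborel)
           = ennreal ((pi * s) powr (real DIM('a) / 2))"
proof -
  have "exp (- (norm h)\<^sup>2 / s) = (\<Prod>b\<in>Basis. exp (- (h \<bullet> b)\<^sup>2 / s))" for h :: 'a
  proof -
    have "(norm h)\<^sup>2 = (\<Sum>b\<in>Basis. (h \<bullet> b)\<^sup>2)"
      unfolding power2_norm_eq_inner by (subst euclidean_inner) (simp add: power2_eq_square)
    then show ?thesis
      by (simp add: exp_sum[symmetric] sum_divide_distrib sum_negf)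
  qed
  then have "(\<integral>\<^sup>+ h. ennreal (exp (- (norm (h :: 'a))\<^sup>2 / s)) \<partial>lborel)
      = (\<integral>\<^sup>+ h. (\<Prod>b\<in>Basis. ennreal (exp (- ((h :: 'a) \<bullet> b)\<^sup>2 / s))) \<partial>lborel)"
    by (simp add: prod_ennreal)
  also have "\<dots> = (\<Prod>b\<in>(Basis :: 'a set). (\<integral>\<^sup>+ x. ennreal (exp (- x\<^sup>2 / s)) \<partial>lborel))"
    by (rule nn_integral_lborel_prod) auto
  also have "\<dots> = ennreal (sqrt (pi * s) ^ DIM('a))"
    unfolding nn_integral_gaussian_real[OF assms] using assms by (simp add: ennreal_power)
  also have "sqrt (pi * s) ^ DIM('a) = (pi * s) powr (real DIM('a) / 2)"
    using assms by (simp add: powr_half_sqrt[symmetric] powr_realpow[symmetric] powr_powr)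
  finally show ?thesis .
qed

text \<open>
  One factor \<open>exp (- |h|\<^sup>2 / (8 * t))\<close> of the Gaussian absorbs the weight, because
  \<open>s * exp (- s / (8 * t)) \<le> 8 * t\<close>; the other one is integrated over the space, and its mass
  cancels the power of \<open>t\<close>.
\<close>

lemma heat_kernel_truncated_moment:
  fixes t :: real
  assumes "0 < t"
  shows "(\<integral>\<^sup>+ h. ennreal (min 1 ((norm (h :: 'a::euclidean_space))\<^sup>2)
             * (t powr (- real DIM('a) / 2) * exp (- (norm h)\<^sup>2 / (4 * t)))) \<partial>lborel)
           \<le> ennreal (8 * (8 * pi) powr (real DIM('a) / 2) * min 1 t)"
proof -
  let ?d = "real DIM('a) / 2"
  have bound: "min 1 s * (t powr (- ?d) * exp (- s / (4 * t)))
      \<le> 8 * min 1 t * t powr (- ?d) * exp (- s / (8 * t))" if "0 \<le> s" for s :: real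
  proof -
    have "s / (8 * t) \<le> exp (s / (8 * t))"
      using exp_ge_add_one_self[of "s / (8 * t)"] by linarith
    then have "s * exp (- (s / (8 * t))) \<le> 8 * t"
      using assms by (simp add: exp_minus field_simps)
    moreover have "min 1 s * exp (- (s / (8 * t))) \<le> s * exp (- (s / (8 * t)))"
      by (intro mult_right_mono) auto
    moreover have "min 1 s * exp (- (s / (8 * t))) \<le> 1 * 1"
      using that assms by (intro mult_mono) auto
    ultimately have "min 1 s * exp (- (s / (8 * t))) \<le> min 8 (8 * t)"
      by linarith
    also have "min 8 (8 * t) = 8 * min 1 t" by (simp add: min_def)
    finally have "min 1 s * exp (- (s / (8 * t))) \<le> 8 * min 1 t" .
    then have "(min 1 s * exp (- (s / (8 * t)))) * (t powr (- ?d) * exp (- s / (8 * t)))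
        \<le> 8 * min 1 t * (t powr (- ?d) * exp (- s / (8 * t)))"
      by (rule mult_right_mono) auto
    moreover have "exp (- s / (4 * t)) = exp (- (s / (8 * t))) * exp (- s / (8 * t))"
      by (simp add: exp_add[symmetric])
    ultimately show ?thesis by (simp add: mult_ac)
  qed
  have "(\<integral>\<^sup>+ h. ennreal (min 1 ((norm (h :: 'a))\<^sup>2)
             * (t powr (- ?d) * exp (- (norm h)\<^sup>2 / (4 * t)))) \<partial>lborel)
      \<le> (\<integral>\<^sup>+ h. ennreal (8 * min 1 t * t powr (- ?d)) * ennreal (exp (- (norm (h :: 'a))\<^sup>2 / (8 * t))) \<partial>lborel)"
    using assms by (intro nn_integral_mono, subst ennreal_mult'[symmetric], simp)
      (rule ennreal_leI, rule bound, simp)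
  also have "\<dots> = ennreal (8 * min 1 t * t powr (- ?d)) * ennreal ((pi * (8 * t)) powr ?d)"
    using assms by (subst nn_integral_cmult) (simp_all only: nn_integral_gaussian, simp_all)
  also have "\<dots> = ennreal (8 * min 1 t * t powr (- ?d) * (pi * (8 * t)) powr ?d)"
    using assms by (simp add: ennreal_mult'[symmetric])
  also have "8 * min 1 t * t powr (- ?d) * (pi * (8 * t)) powr ?d = 8 * (8 * pi) powr ?d * min 1 t"
  proof -
    have "(pi * (8 * t)) powr ?d = (8 * pi) powr ?d * t powr ?d"
      using assms powr_mult[of "8 * pi" t ?d] by (simp add: mult_ac)
    moreover have "t powr (- ?d) * t powr ?d = 1"
      using assms by (simp add: powr_add[symmetric])
    ultimately show ?thesis by (simp add: mult_ac)
  qed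
  finally show ?thesis by (simp only: minus_divide_left)
qed

section \<open>The Levy property of the jump kernel\<close>

lemma completely_monotone_nonneg:
  assumes "completely_monotone \<mu>" and "0 < t"
  shows "0 \<le> \<mu> t"
  using assms(1)[unfolded completely_monotone_def, rule_format, of t 0] assms(2) by simp

lemma completely_monotone_measurable:
  assumes "completely_monotone \<mu>"
  shows "(\<lambda>t. indicator {0<..} t * \<mu> t) \<in> borel_measurable borel"
proof -
  have "\<mu> differentiable (at t)" if "0 < t" for t
    using assms[unfolded completely_monotone_def, rule_format, of t 0] that by simp
  then have "continuous_on {0<..} \<mu>"
    by (auto intro!: continuous_at_imp_continuous_on differentiable_imp_continuous_within)
  then have "(\<lambda>t. indicator {0<..} t *\<^sub>R \<mu> t) \<in> borel_measurable borel"
    by (intro borel_measurable_continuous_on_indicator) auto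
  then show ?thesis by simp
qed

lemma jump_kernel_nonneg:
  assumes "completely_monotone \<mu>"
  shows "0 \<le> jump_kernel d \<mu> r"
  unfolding jump_kernel_def set_lebesgue_integral_def
  by (intro mult_nonneg_nonneg integral_nonneg_AE AE_I2)
     (auto simp: indicator_def completely_monotone_nonneg[OF assms])

text \<open>
  Tonelli's theorem and the measurability of parametric integrals need product-measurable
  integrands, which are at hand for Borel measurability; hence the passage from the
  completed measure to Borel functions on the whole line.
\<close>

lemma jump_kernel_lborel:
  assumes "completely_monotone \<mu>"
  shows "jump_kernel d \<mu> r = (4 * pi) powr (- real d / 2) *
     (LINT t|lborel. t powr (- real d / 2) * exp (- r\<^sup>2 / (4 * t)) * (indicator {0<..} t * \<mu> t))"
proof -
  note [measurable] = completely_monotone_measurable[OF assms]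
  have "(LINT t:{0<..}|lebesgue. t powr (- real d / 2) * exp (- r\<^sup>2 / (4 * t)) * \<mu> t)
      = (LINT t|lebesgue. t powr (- real d / 2) * exp (- r\<^sup>2 / (4 * t)) * (indicator {0<..} t * \<mu> t))"
    unfolding set_lebesgue_integral_def by (simp add: mult_ac)
  also have "\<dots> = (LINT t|lborel. t powr (- real d / 2) * exp (- r\<^sup>2 / (4 * t)) * (indicator {0<..} t * \<mu> t))"
    by (rule integral_completion) measurable
  finally show ?thesis unfolding jump_kernel_def by simp
qed

lemma jump_kernel_measurable:
  assumes "completely_monotone \<mu>"
  shows "jump_kernel d \<mu> \<in> borel_measurable borel"
proof -
  note [measurable] = completely_monotone_measurable[OF assms]
  show ?thesis
    unfolding jump_kernel_lborel[OF assms, abs_def] by measurable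
qed

text \<open>
  Tonelli's theorem reduces the claim to the heat-kernel bound at each time \<open>t\<close>. At a
  given radius the kernel is a Bochner integral with a nonnegative integrand, and whether that
  integral converges or takes its default value \<open>0\<close>, it is at most the nonnegative integral.
\<close>

lemma jump_kernel_Levy_integrable:
  assumes "completely_monotone \<mu>"
    and "set_integrable lebesgue {0<..} (\<lambda>t. min 1 t * \<mu> t)"
  shows "integrable lborel
    (\<lambda>h :: 'a::euclidean_space. min 1 ((norm h)\<^sup>2) * jump_kernel DIM('a) \<mu> (norm h))"
proof (rule integrableI_bounded)
  define m where "m t = indicator {0<..} t * \<mu> t" for t
  have [measurable]: "m \<in> borel_measurable borel"
    unfolding m_def using completely_monotone_measurable[OF assms(1)] .
  have m0: "0 \<le> m t" for t
    by (auto simp: m_def indicator_def completely_monotone_nonneg[OF assms(1)])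
  note [measurable] = jump_kernel_measurable[OF assms(1)]
  show "(\<lambda>h :: 'a. min 1 ((norm h)\<^sup>2) * jump_kernel DIM('a) \<mu> (norm h)) \<in> borel_measurable lborel"
    by measurable
  let ?e = "- real DIM('a) / 2"
  let ?c = "(4 * pi) powr ?e"
  let ?K = "8 * (8 * pi) powr (real DIM('a) / 2)"
  let ?k = "\<lambda>(h :: 'a) t. t powr ?e * exp (- (norm h)\<^sup>2 / (4 * t))"
  have "ennreal (norm (min 1 ((norm h)\<^sup>2) * jump_kernel DIM('a) \<mu> (norm h)))
      \<le> ennreal ?c * (\<integral>\<^sup>+ t. ennreal (min 1 ((norm h)\<^sup>2) * ?k h t * m t) \<partial>lborel)" for h :: 'a
  proof -
    have "ennreal (LINT t|lborel. ?k h t * m t) \<le> (\<integral>\<^sup>+ t. ennreal (?k h t * m t) \<partial>lborel)"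
      using integral_norm_bound_ennreal[of lborel "\<lambda>t. ?k h t * m t"] m0
        integral_nonneg_AE[of "\<lambda>t. ?k h t * m t" lborel]
      by (cases "integrable lborel (\<lambda>t. ?k h t * m t)")
         (auto simp: not_integrable_integral_eq)
    then have "ennreal (min 1 ((norm h)\<^sup>2)) * ennreal (LINT t|lborel. ?k h t * m t)
        \<le> (\<integral>\<^sup>+ t. ennreal (min 1 ((norm h)\<^sup>2) * ?k h t * m t) \<partial>lborel)"
      by (subst mult.assoc, subst ennreal_mult', simp, subst nn_integral_cmult)
         (auto intro!: mult_left_mono)
    moreover have "norm (min 1 ((norm h)\<^sup>2) * jump_kernel DIM('a) \<mu> (norm h))
        = ?c * (min 1 ((norm h)\<^sup>2) * (LINT t|lborel. ?k h t * m t))"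
      using jump_kernel_nonneg[OF assms(1), of "DIM('a)" "norm h"]
      by (simp add: abs_mult) (simp add: jump_kernel_lborel[OF assms(1)] m_def mult_ac)
    moreover have "0 \<le> (LINT t|lborel. ?k h t * m t)"
      using m0 by (intro integral_nonneg_AE) auto
    ultimately show ?thesis
      by (simp add: ennreal_mult' mult_left_mono)
  qed
  then have "(\<integral>\<^sup>+ h. ennreal (norm (min 1 ((norm h)\<^sup>2) * jump_kernel DIM('a) \<mu> (norm (h :: 'a)))) \<partial>lborel)
      \<le> (\<integral>\<^sup>+ h. ennreal ?c * (\<integral>\<^sup>+ t. ennreal (min 1 ((norm h)\<^sup>2) * ?k h t * m t) \<partial>lborel) \<partial>lborel)"
    by (rule nn_integral_mono)
  also have "\<dots> = ennreal ?c *
      (\<integral>\<^sup>+ h. \<integral>\<^sup>+ t. ennreal (min 1 ((norm (h :: 'a))\<^sup>2) * ?k h t * m t) \<partial>lborel \<partial>lborel)"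
    by (rule nn_integral_cmult) measurable
  also have "\<dots> = ennreal ?c *
      (\<integral>\<^sup>+ t. \<integral>\<^sup>+ h. ennreal (min 1 ((norm (h :: 'a))\<^sup>2) * ?k h t * m t) \<partial>lborel \<partial>lborel)"
    by (subst lborel_pair.Fubini') auto
  also have "\<dots> \<le> ennreal ?c * (\<integral>\<^sup>+ t. ennreal (?K * (min 1 t * m t)) \<partial>lborel)"
  proof (intro mult_left_mono nn_integral_mono)
    fix t :: real
    show "(\<integral>\<^sup>+ h. ennreal (min 1 ((norm (h :: 'a))\<^sup>2) * ?k h t * m t) \<partial>lborel)
        \<le> ennreal (?K * (min 1 t * m t))"
    proof (cases "0 < t")
      case True
      have "(\<integral>\<^sup>+ h. ennreal (min 1 ((norm (h :: 'a))\<^sup>2) * ?k h t * m t) \<partial>lborel)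
          = ennreal (m t) * (\<integral>\<^sup>+ h. ennreal (min 1 ((norm (h :: 'a))\<^sup>2) * ?k h t) \<partial>lborel)"
        using m0 by (subst nn_integral_cmult[symmetric])
          (auto simp: ennreal_mult'[symmetric] mult_ac)
      also have "\<dots> \<le> ennreal (m t) * ennreal (?K * min 1 t)"
        by (intro mult_left_mono heat_kernel_truncated_moment[OF True]) auto
      also have "\<dots> = ennreal (?K * (min 1 t * m t))"
        using m0[of t] by (simp add: ennreal_mult'[symmetric] mult_ac)
      finally show ?thesis .
    qed (simp add: m_def)
  qed simp
  also have "\<dots> < \<infinity>"
  proof -
    have "integrable lebesgue (\<lambda>t. min 1 t * m t)"
      using assms(2) by (simp add: set_integrable_def m_def mult_ac)
    then have "integrable lborel (\<lambda>t. min 1 t * m t)"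
      by (subst (asm) integrable_completion) auto
    then have "integrable lborel (\<lambda>t. ?K * (min 1 t * m t))"
      by (rule integrable_mult_right)
    moreover have "norm (?K * (min 1 t * m t)) = ?K * (min 1 t * m t)" for t
      by (cases "0 < t") (auto simp: m_def completely_monotone_nonneg[OF assms(1)])
    ultimately have "(\<integral>\<^sup>+ t. ennreal (?K * (min 1 t * m t)) \<partial>lborel) < \<infinity>"
      unfolding integrable_iff_bounded by (simp only:)
    then show ?thesis
      by (simp add: ennreal_mult_less_top)
  qed
  finally show "(\<integral>\<^sup>+ h. ennreal (norm (min 1 ((norm h)\<^sup>2) * jump_kernel DIM('a) \<mu> (norm (h :: 'a)))) \<partial>lborel) < \<infinity>" .
qed

section \<open>Essential bounds on second differences\<close>

text \<open>The two values \<open>c = 1\<close> and \<open>c = - 1\<close> give the points \<open>x + h\<close> and \<open>x - h\<close> of a second difference.\<close>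

lemma lebesgue_reflect_translate:
  fixes x :: "'a::euclidean_space" and c :: real
  assumes "\<bar>c\<bar> = 1"
  shows lebesgue_reflect_translate_measurable: "(\<lambda>h. x + c *\<^sub>R h) \<in> lebesgue \<rightarrow>\<^sub>M lebesgue"
    and distr_lebesgue_reflect_translate: "distr lebesgue lebesgue (\<lambda>h. x + c *\<^sub>R h) = lebesgue"
proof -
  have "x + (\<Sum>j\<in>Basis. (c * (h \<bullet> j)) *\<^sub>R j) = x + c *\<^sub>R h" for h
    by (simp add: scaleR_scaleR[symmetric] scaleR_sum_right[symmetric] euclidean_representation
        del: scaleR_scaleR)
  then show "(\<lambda>h. x + c *\<^sub>R h) \<in> lebesgue \<rightarrow>\<^sub>M lebesgue"
    and "distr lebesgue lebesgue (\<lambda>h. x + c *\<^sub>R h) = lebesgue"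
    using lebesgue_affine_measurable[of "\<lambda>_. c" x] lebesgue_affine_euclidean[of "\<lambda>_. c" x] assms
    by (auto simp: density_1)
qed

lemma AE_lebesgue_reflect_translate:
  fixes x :: "'a::euclidean_space" and c :: real
  assumes "\<bar>c\<bar> = 1" and "AE y in lebesgue. P y"
  shows "AE h in lebesgue. P (x + c *\<^sub>R h)"
  by (rule AE_distrD[OF lebesgue_reflect_translate_measurable[OF assms(1)]])
     (simp only: distr_lebesgue_reflect_translate[OF assms(1)] assms(2))

text \<open>
  The conversion from an extended real is harmless: the essential supremum is finite by
  assumption and nonnegative because the space has positive measure.
\<close>

lemma Linf_norm_bound:
  fixes f :: "'a::euclidean_space \<Rightarrow> real"
  assumes "f \<in> Linf_space lebesgue"
  shows "AE x in lebesgue. \<bar>f x\<bar> \<le> Linf_norm lebesgue f"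
proof -
  have [measurable]: "f \<in> borel_measurable lebesgue"
    and fin: "esssup lebesgue (\<lambda>x. ereal \<bar>f x\<bar>) < \<infinity>"
    using assms by (auto simp: Linf_space_def)
  have "esssup lebesgue (\<lambda>x :: 'a. ereal 0) \<le> esssup lebesgue (\<lambda>x. ereal \<bar>f x\<bar>)"
    by (rule esssup_mono) auto
  then have "0 \<le> esssup lebesgue (\<lambda>x. ereal \<bar>f x\<bar>)"
    by (simp add: esssup_const zero_ereal_def)
  with fin have "ereal (Linf_norm lebesgue f) = esssup lebesgue (\<lambda>x. ereal \<bar>f x\<bar>)"
    unfolding Linf_norm_def by (cases "esssup lebesgue (\<lambda>x. ereal \<bar>f x\<bar>)") auto
  then show ?thesis
    using esssup_AE[of "\<lambda>x. ereal \<bar>f x\<bar>" lebesgue] by (simp flip: ereal_less_eq(3))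
qed

lemma AE_lebesgue_obtain_small:
  assumes "AE h in lebesgue. P (h :: 'a::euclidean_space)" and "0 < r"
  obtains h where "norm h < r" and "P h"
proof -
  have "\<exists>h \<in> ball 0 r. P h"
  proof (rule ccontr)
    assume "\<not> (\<exists>h \<in> ball 0 r. P h)"
    then have "AE h in lebesgue. h \<notin> ball (0 :: 'a) r"
      by (intro eventually_mono[OF assms(1)]) auto
    then have "negligible (ball (0 :: 'a) r)"
      by (subst (asm) AE_iff_null_sets[symmetric]) (auto simp: negligible_iff_null_sets)
    then show False
      using open_not_negligible[of "ball (0 :: 'a) r"] assms(2) by auto
  qed
  then show ?thesis using that by auto
qed

text \<open>
  The values \<open>\<phi> (x + h)\<close> and \<open>\<phi> (x - h)\<close> are at most \<open>\<parallel>\<phi>\<parallel>\<^sub>\<infinity>\<close> for almost every \<open>h\<close>, hence for some \<open>h\<close> of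
  arbitrarily small norm. There the local bound compares \<open>2 * \<phi> x\<close> with their sum up to an
  arbitrarily small error, so \<open>\<phi> x \<le> \<parallel>\<phi>\<parallel>\<^sub>\<infinity>\<close> as well. As \<open>\<phi>\<close> is nonnegative, the two parts of the second
  difference have opposite signs and each lies within \<open>2 * \<parallel>\<phi>\<parallel>\<^sub>\<infinity>\<close>; the triangle inequality
  alone would give \<open>4 * \<parallel>\<phi>\<parallel>\<^sub>\<infinity>\<close>.
\<close>

lemma second_diff_AE_bound:
  fixes \<phi> :: "'a::euclidean_space \<Rightarrow> real"
  assumes "\<phi> \<in> Linf_space lebesgue" and nonneg: "\<And>y. 0 \<le> \<phi> y"
    and "0 < R" and near: "\<And>h. norm h < R \<Longrightarrow> \<bar>second_diff h \<phi> x\<bar> \<le> A * (norm h)\<^sup>2"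
  shows "AE h in lebesgue. \<bar>second_diff h \<phi> x\<bar> \<le> 2 * Linf_norm lebesgue \<phi>"
proof -
  let ?N = "Linf_norm lebesgue \<phi>"
  have N: "AE y in lebesgue. \<phi> y \<le> ?N"
    using Linf_norm_bound[OF assms(1)] by eventually_elim auto
  have sides: "AE h in lebesgue. \<phi> (x + h) \<le> ?N \<and> \<phi> (x - h) \<le> ?N"
    using AE_lebesgue_reflect_translate[OF _ N, of 1 x] AE_lebesgue_reflect_translate[OF _ N, of "- 1" x]
    by simp
  have "2 * \<phi> x \<le> 2 * ?N + e" if "0 < e" for e
  proof -
    \<comment> \<open>Within this radius the quadratic error term is at most \<open>e\<close>; the \<open>1\<close> covers \<open>A = 0\<close>.\<close>
    define r where "r = min R (sqrt (e / (\<bar>A\<bar> + 1)))"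
    have "0 < r" using assms(3) that by (simp add: r_def)
    then obtain h where h: "norm h < r" "\<phi> (x + h) \<le> ?N" "\<phi> (x - h) \<le> ?N"
      using AE_lebesgue_obtain_small[OF sides] by metis
    have "(norm h)\<^sup>2 \<le> (sqrt (e / (\<bar>A\<bar> + 1)))\<^sup>2"
      using h(1) by (intro power_mono) (auto simp: r_def)
    then have "(norm h)\<^sup>2 \<le> e / (\<bar>A\<bar> + 1)"
      using that by simp
    then have "(\<bar>A\<bar> + 1) * (norm h)\<^sup>2 \<le> e"
      by (simp add: field_simps)
    moreover have "A * (norm h)\<^sup>2 \<le> (\<bar>A\<bar> + 1) * (norm h)\<^sup>2"
      by (intro mult_right_mono) auto
    moreover have "\<bar>second_diff h \<phi> x\<bar> \<le> A * (norm h)\<^sup>2"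
      using near h(1) by (simp add: r_def)
    ultimately show ?thesis
      using h(2,3) by (simp add: second_diff_def)
  qed
  then have "2 * \<phi> x \<le> 2 * ?N" by (rule field_le_epsilon)
  from sides show ?thesis
  proof eventually_elim
    case (elim h)
    then show ?case
      using \<open>2 * \<phi> x \<le> 2 * ?N\<close> nonneg[of x] nonneg[of "x + h"] nonneg[of "x - h"]
      unfolding second_diff_def by linarith
  qed
qed

section \<open>Splitting the jump integral\<close>

text \<open>
  The majorant is \<open>A * |h|\<^sup>2 * j\<close> inside the ball and \<open>B * j\<close> outside. Both pieces are dominated
  by multiples of the Levy integrand \<open>min 1 |h|\<^sup>2 * j\<close>, with factors depending on \<open>R\<close>,
  so the same majorant yields absolute convergence and the estimate.
\<close>

lemma jump_integral_split:
  fixes \<phi> :: "real ^ 'd::finite \<Rightarrow> real" and x :: "real ^ 'd"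
  assumes "completely_monotone \<mu>"
    and "set_integrable lebesgue {0<..} (\<lambda>t. min 1 t * \<mu> t)"
    and "\<phi> \<in> borel_measurable lebesgue" and "0 < R"
    and near: "\<And>h. norm h < R \<Longrightarrow> \<bar>second_diff h \<phi> x\<bar> \<le> A * (norm h)\<^sup>2"
    and far: "AE h in lebesgue. \<bar>second_diff h \<phi> x\<bar> \<le> B"
  shows jump_integrand_integrable:
      "integrable lebesgue (\<lambda>h. second_diff h \<phi> x * jump_kernel CARD('d) \<mu> (norm h))"
    and jump_integral_bound:
      "\<bar>LINT h|lebesgue. second_diff h \<phi> x * jump_kernel CARD('d) \<mu> (norm h)\<bar>
         \<le> A * jump_second_moment TYPE('d) \<mu> R
           + B * measure (jump_measure \<mu> :: (real ^ 'd) measure) (- ball 0 R)"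
proof -
  define j where "j h = jump_kernel CARD('d) \<mu> (norm h)" for h :: "real ^ 'd"
  have j0: "0 \<le> j h" for h
    unfolding j_def by (rule jump_kernel_nonneg[OF assms(1)])
  note [measurable] = jump_kernel_measurable[OF assms(1)]
  have jborel: "j \<in> borel_measurable lborel"
    unfolding j_def by measurable
  then have [measurable]: "j \<in> borel_measurable lebesgue"
    by (rule measurable_completion)
  have [measurable]: "\<phi> \<in> borel_measurable lebesgue" by fact
  have "(\<lambda>h. \<phi> (x + h)) \<in> borel_measurable lebesgue" "(\<lambda>h. \<phi> (x - h)) \<in> borel_measurable lebesgue"
    using measurable_compose[OF lebesgue_reflect_translate_measurable[of 1 x] assms(3)]
      measurable_compose[OF lebesgue_reflect_translate_measurable[of "- 1" x] assms(3)] by auto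
  then have [measurable]: "(\<lambda>h. second_diff h \<phi> x) \<in> borel_measurable lebesgue"
    unfolding second_diff_def by measurable
  have Levy: "integrable lebesgue (\<lambda>h. min 1 ((norm h)\<^sup>2) * j h)"
    using jump_kernel_Levy_integrable[OF assms(1,2), where 'a = "real ^ 'd"] jborel
    by (subst integrable_completion) (auto simp: j_def)
  have norm_meas [measurable]: "(\<lambda>h :: real ^ 'd. norm h) \<in> borel_measurable lebesgue"
    by (rule measurable_completion) auto
  have ball_sets [measurable]: "ball (0 :: real ^ 'd) R \<in> sets lebesgue" "- ball (0 :: real ^ 'd) R \<in> sets lebesgue"
    by auto
  have inner: "integrable lebesgue (\<lambda>h. indicator (ball 0 R) h * ((norm h)\<^sup>2 * j h))"
  proof (rule Bochner_Integration.integrable_bound[OF integrable_mult_right[OF Levy, of "max 1 (R\<^sup>2)"]])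
    show "AE h in lebesgue. norm (indicator (ball 0 R) h * ((norm h)\<^sup>2 * j h))
        \<le> norm (max 1 (R\<^sup>2) * (min 1 ((norm h)\<^sup>2) * j h))"
    proof (rule AE_I2)
      fix h :: "real ^ 'd"
      have "(norm h)\<^sup>2 \<le> max 1 (R\<^sup>2) * min 1 ((norm h)\<^sup>2)" if "norm h < R"
      proof (cases "1 \<le> (norm h)\<^sup>2")
        case True
        then show ?thesis using power_mono[of "norm h" R 2] that by auto
      next
        case False
        have "1 * (norm h)\<^sup>2 \<le> max 1 (R\<^sup>2) * (norm h)\<^sup>2" by (rule mult_right_mono) auto
        with False show ?thesis by auto
      qed
      then show "norm (indicator (ball 0 R) h * ((norm h)\<^sup>2 * j h))
          \<le> norm (max 1 (R\<^sup>2) * (min 1 ((norm h)\<^sup>2) * j h))"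
        using j0[of h] by (auto simp: indicator_def abs_mult mult.assoc[symmetric] intro!: mult_right_mono)
    qed
  qed measurable
  have outer: "integrable lebesgue (\<lambda>h. indicator (- ball 0 R) h * j h)"
  proof (rule Bochner_Integration.integrable_bound[OF integrable_mult_right[OF Levy, of "max 1 (1 / R\<^sup>2)"]])
    show "AE h in lebesgue. norm (indicator (- ball 0 R) h * j h)
        \<le> norm (max 1 (1 / R\<^sup>2) * (min 1 ((norm h)\<^sup>2) * j h))"
    proof (rule AE_I2)
      fix h :: "real ^ 'd"
      have "1 \<le> max 1 (1 / R\<^sup>2) * min 1 ((norm h)\<^sup>2)" if "R \<le> norm h"
      proof (cases "1 \<le> (norm h)\<^sup>2")
        case False
        have "1 = 1 / R\<^sup>2 * R\<^sup>2" using \<open>0 < R\<close> by simp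
        also have "\<dots> \<le> max 1 (1 / R\<^sup>2) * (norm h)\<^sup>2"
          using \<open>0 < R\<close> that by (intro mult_mono power_mono) auto
        also have "(norm h)\<^sup>2 = min 1 ((norm h)\<^sup>2)" using False by simp
        finally show ?thesis .
      qed auto
      then have "1 * j h \<le> max 1 (1 / R\<^sup>2) * min 1 ((norm h)\<^sup>2) * j h" if "R \<le> norm h"
        using that j0[of h] by (intro mult_right_mono) auto
      then show "norm (indicator (- ball 0 R) h * j h)
          \<le> norm (max 1 (1 / R\<^sup>2) * (min 1 ((norm h)\<^sup>2) * j h))"
        using j0[of h] by (auto simp: indicator_def abs_mult mult.assoc[symmetric])
    qed
  qed measurable
  let ?G = "\<lambda>h. A * (indicator (ball 0 R) h * ((norm h)\<^sup>2 * j h)) + B * (indicator (- ball 0 R) h * j h)"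
  have G: "integrable lebesgue ?G"
    using inner outer by simp
  have dom: "AE h in lebesgue. norm (second_diff h \<phi> x * j h) \<le> ?G h"
    using far
  proof eventually_elim
    case (elim h)
    then show ?case
      using near[of h] j0[of h] mult_right_mono[of "\<bar>second_diff h \<phi> x\<bar>" "A * (norm h)\<^sup>2" "j h"]
      by (auto simp: indicator_def abs_mult mult.assoc intro!: mult_right_mono)
  qed
  show int: "integrable lebesgue (\<lambda>h. second_diff h \<phi> x * jump_kernel CARD('d) \<mu> (norm h))"
    unfolding j_def[symmetric]
    by (rule Bochner_Integration.integrable_bound[OF G])
       (use dom in \<open>auto elim!: eventually_mono\<close>)
  \<comment> \<open>The jump measure lives on the complement of the origin, which contains that of the ball as \<open>R > 0\<close>.\<close>
  have tail: "(LINT h|lebesgue. indicator (- ball 0 R) h * j h)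
      = measure (jump_measure \<mu> :: (real ^ 'd) measure) (- ball 0 R)"
  proof -
    have sub: "- ball 0 R \<subseteq> - {0 :: real ^ 'd}" using \<open>0 < R\<close> by auto
    have sets': "- ball (0 :: real ^ 'd) R \<in> sets (lebesgue_on (- {0}))"
      using sub by (subst sets_restrict_space_iff) auto
    have "emeasure (jump_measure \<mu> :: (real ^ 'd) measure) (- ball 0 R)
        = (\<integral>\<^sup>+ h. ennreal (j h) * indicator (- ball 0 R) h \<partial>lebesgue_on (- {0}))"
      unfolding jump_measure_def j_def[symmetric]
      by (rule emeasure_density[OF _ sets']) (auto intro!: measurable_restrict_space1)
    also have "\<dots> = (\<integral>\<^sup>+ h. ennreal (j h) * indicator (- ball 0 R) h * indicator (- {0}) h \<partial>lebesgue)"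
      by (rule nn_integral_restrict_space) auto
    also have "\<dots> = (\<integral>\<^sup>+ h. ennreal (indicator (- ball 0 R) h * j h) \<partial>lebesgue)"
      using \<open>0 < R\<close> by (intro nn_integral_cong) (auto simp: indicator_def)
    also have "\<dots> = ennreal (LINT h|lebesgue. indicator (- ball 0 R) h * j h)"
      using outer j0 by (intro nn_integral_eq_integral) auto
    finally show ?thesis
      using j0 by (simp add: measure_def integral_nonneg_AE)
  qed
  have "\<bar>LINT h|lebesgue. second_diff h \<phi> x * j h\<bar> \<le> (LINT h|lebesgue. ?G h)"
  proof -
    have "norm (LINT h|lebesgue. second_diff h \<phi> x * j h) \<le> (LINT h|lebesgue. norm (second_diff h \<phi> x * j h))"
      by (rule integral_norm_bound)
    also have "\<dots> \<le> (LINT h|lebesgue. ?G h)"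
      using int G dom by (intro integral_mono_AE integrable_norm) (auto simp: j_def)
    finally show ?thesis by simp
  qed
  also have "\<dots> = A * jump_second_moment TYPE('d) \<mu> R
      + B * measure (jump_measure \<mu> :: (real ^ 'd) measure) (- ball 0 R)"
    using inner outer
    unfolding jump_second_moment_def set_lebesgue_integral_def j_def[symmetric]
    by (simp add: tail)
  finally show "\<bar>LINT h|lebesgue. second_diff h \<phi> x * jump_kernel CARD('d) \<mu> (norm h)\<bar>
         \<le> A * jump_second_moment TYPE('d) \<mu> R
           + B * measure (jump_measure \<mu> :: (real ^ 'd) measure) (- ball 0 R)"
    by (simp add: j_def)
qed

section \<open>The bound on the potential and its decay\<close>

theorem theorem4p1:
  fixes \<Phi> \<mu> :: "real \<Rightarrow> real"
    and V \<phi> L :: "real ^ 'd::finite \<Rightarrow> real"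
    and C M :: real
  assumes "zero_energy_setting \<Phi> \<mu> V \<phi>"
    and "0 < C" and "C < 1"
    and "\<phi> \<in> Z_space C"
    and "Z_bound C \<phi> M L"
  shows "(\<forall>x \<in> - ball 0 M.
            \<bar>V x\<bar> \<le> 1 / 2 * (L x / \<phi> x) * jump_second_moment TYPE('d) \<mu> (C * norm x)
              + 2 * Linf_norm lebesgue \<phi> *
                (measure (jump_measure \<mu> :: (real ^ 'd) measure) (- ball 0 (C * norm x)) / \<phi> x))
       \<and> (((\<lambda>x. L x * jump_second_moment TYPE('d) \<mu> (C * norm x) / \<phi> x) \<longlongrightarrow> 0) at_infinity
          \<longrightarrow> ((\<lambda>x. measure (jump_measure \<mu> :: (real ^ 'd) measure) (- ball 0 (C * norm x)) / \<phi> x)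
                \<longlongrightarrow> 0) at_infinity
          \<longrightarrow> (V \<longlongrightarrow> 0) at_infinity)"
proof (intro conjI impI)
  let ?N = "Linf_norm lebesgue \<phi>"
  let ?J = "\<lambda>x :: real ^ 'd. jump_second_moment TYPE('d) \<mu> (C * norm x)"
  let ?\<nu> = "\<lambda>x :: real ^ 'd. measure (jump_measure \<mu> :: (real ^ 'd) measure) (- ball 0 (C * norm x))"
  have \<mu>: "completely_monotone \<mu>" "set_integrable lebesgue {0<..} (\<lambda>t. min 1 t * \<mu> t)"
    and \<phi>: "\<phi> \<in> Linf_space lebesgue" "\<And>x. 0 < \<phi> x"
    and V: "pointwise_potential \<mu> \<phi> V"
    using assms(1) by (auto simp: zero_energy_setting_def complete_Bernstein_with_density_def)
  have "0 < M"
    and Z: "\<And>x h. M \<le> norm x \<Longrightarrow> norm h < C * norm x \<Longrightarrow> \<bar>second_diff h \<phi> x\<bar> \<le> L x * (norm h)\<^sup>2"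
    using assms(5) by (auto simp: Z_bound_def)
  have "AE y :: real ^ 'd in lebesgue. 0 \<le> ?N"
    by (rule eventually_mono[OF Linf_norm_bound[OF \<phi>(1)]]) auto
  then have N: "0 \<le> ?N"
    using AE_lebesgue_obtain_small[of "\<lambda>_ :: real ^ 'd. 0 \<le> ?N" 1] by auto
  show bound: "\<forall>x \<in> - ball 0 M. \<bar>V x\<bar> \<le> 1 / 2 * (L x / \<phi> x) * ?J x + 2 * ?N * (?\<nu> x / \<phi> x)"
  proof
    fix x :: "real ^ 'd"
    assume "x \<in> - ball 0 M"
    then have x: "M \<le> norm x" by auto
    then have R: "0 < C * norm x" using \<open>0 < M\<close> assms(2) by (intro mult_pos_pos) linarith+
    have far: "AE h in lebesgue. \<bar>second_diff h \<phi> x\<bar> \<le> 2 * ?N"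
      using second_diff_AE_bound[OF \<phi>(1) less_imp_le[OF \<phi>(2)] R Z[OF x]] .
    have meas: "\<phi> \<in> borel_measurable lebesgue"
      using \<phi>(1) by (simp add: Linf_space_def)
    let ?I = "LINT h|lebesgue. second_diff h \<phi> x * jump_kernel CARD('d) \<mu> (norm h)"
    have "V x = 1 / (2 * \<phi> x) * ?I"
      using V jump_integrand_integrable[OF \<mu> meas R Z[OF x] far]
      by (simp add: pointwise_potential_def)
    then have "\<bar>V x\<bar> = 1 / (2 * \<phi> x) * \<bar>?I\<bar>"
      using \<phi>(2)[of x] by (simp add: abs_mult)
    also have "\<dots> \<le> 1 / (2 * \<phi> x) * (L x * ?J x + 2 * ?N * ?\<nu> x)"
      using \<phi>(2)[of x] by (intro mult_left_mono jump_integral_bound[OF \<mu> meas R Z[OF x] far]) auto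
    also have "\<dots> = 1 / 2 * (L x / \<phi> x) * ?J x + ?N * (?\<nu> x / \<phi> x)"
      using \<phi>(2)[of x] by (simp add: field_simps)
    \<comment> \<open>The positivity of \<open>\<phi>\<close> has saved a factor \<open>2\<close> in the tail term, which is given up here.\<close>
    also have "\<dots> \<le> 1 / 2 * (L x / \<phi> x) * ?J x + 2 * ?N * (?\<nu> x / \<phi> x)"
      using N \<phi>(2)[of x] by (intro add_left_mono mult_right_mono) auto
    finally show "\<bar>V x\<bar> \<le> 1 / 2 * (L x / \<phi> x) * ?J x + 2 * ?N * (?\<nu> x / \<phi> x)" .
  qed
  assume J0: "((\<lambda>x. L x * ?J x / \<phi> x) \<longlongrightarrow> 0) at_infinity"
    and \<nu>0: "((\<lambda>x. ?\<nu> x / \<phi> x) \<longlongrightarrow> 0) at_infinity"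
  have "((\<lambda>x. 1 / 2 * (L x * ?J x / \<phi> x) + 2 * ?N * (?\<nu> x / \<phi> x)) \<longlongrightarrow> 1 / 2 * 0 + 2 * ?N * 0) at_infinity"
    by (intro tendsto_add tendsto_mult_left J0 \<nu>0)
  moreover have "\<forall>\<^sub>F x in at_infinity.
      norm (V x) \<le> 1 / 2 * (L x * ?J x / \<phi> x) + 2 * ?N * (?\<nu> x / \<phi> x)"
    unfolding eventually_at_infinity using bound by (intro exI[of _ M]) auto
  ultimately show "(V \<longlongrightarrow> 0) at_infinity"
    by (auto intro: Lim_null_comparison)
qed

end
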